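(* Consider the minimum delay broadcast problem with mutual information accumulation (as defined in the context), and suppose it has an optimal solution. Then, under the optimal solution, in each stage $j$ it is optimal for at most one node to transmit. Precisely: there is an optimal solution, consisting of a decoding order $\mathcal{O}_{opt}$ (with nodes labeled $0,1,\ldots,n$ accordingly, $0$ being the source) and durations $(A_{ij})$, $(\Delta_j)$, such that for every stage $j\in\{0,1,\ldots,n-1\}$ there is at most one $i$ with $A_{ij}>0$.
   Context: Network: a source $s$ and $n$ other nodes. For each ordered pair of distinct nodes $(i,j)$ there is a fixed link capacity $C_{ij}\ge 0$ (transmit powers are fixed, bandwidth is normalized to $1$): if node $i$ transmits for a duration $\Delta$, every other node $j$ that does not yet have the packet accumulates $\Delta\, C_{ij}$ bits of mutual information, and contributions from different transmissions add up. A node can transmit only after it has decoded the packet, which requires accumulating at least $I_{max}>0$ bits. Initially only $s$ has the packet; the goal is to deliver it to all $n$ nodes in minimum time. Transmissions are orthogonal in time (at most one node transmits at any moment). Let $\mathcal{O}$ be an ordering of the $n$ nodes (the decoding order); label them $1,\ldots,n$ according to $\mathcal{O}$ and the source $0$. Let $t_0$ be the start time and $t_m$ the decoding time of node $m$, $t_0\le t_1\le\cdots\le t_n$. Stage $j$ ($0\le j\le n-1$) is the interval $[t_j,t_{j+1}]$, with duration $\Delta_j=t_{j+1}-t_j$, and $A_{ij}$ is the transmission duration of node $i$ in stage $j$. For given $\mathcal{O}$ the minimum broadcast delay is the value of the linear program $$\text{minimize } T_{tot}=\sum_{j=0}^{n-1}\Delta_j$$ subject to $$\sum_{i=0}^{m-1}\sum_{j=0}^{m-1}A_{ij}C_{im}\ge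 I_{max}\ \ \forall m\in\{1,\ldots,n\},\qquad \sum_{i=0}^{j}A_{ij}\le\Delta_j\ \ \forall j\in\{0,\ldots,n-1\},$$ $$A_{ij}\ge 0\ \ \forall i,j\in\{0,\ldots,n-1\},\qquad A_{ij}=0\ \ \forall i>j,\qquad \Delta_j\ge 0\ \ \forall j\in\{0,\ldots,n-1\}.$$ The minimum delay broadcast problem is to minimize $T_{tot}$ over all orderings $\mathcal{O}$ of the $n$ nodes and all feasible $(A_{ij}),(\Delta_j)$. An optimal solution is a choice $(\mathcal{O},(A_{ij}),(\Delta_j))$ attaining this overall minimum. *)

theory Defs
  imports Complex_Main
begin

text \<open>
  The network consists of a source \<open>s\<close> and a set \<open>N\<close> of \<open>n\<close> further nodes;
  \<open>C u v\<close> is the capacity of the link from \<open>u\<close> to \<open>v\<close>.  A decoding order \<open>ord\<close> maps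
  the label \<open>m \<le> n\<close> to the node carrying it, so that in the labelled notation \<open>C\<^sub>i\<^sub>m\<close> is
  \<open>C (ord i) (ord m)\<close>.  Only the values \<open>ord m\<close> with \<open>m \<le> n\<close> and the values \<open>A i j\<close>,
  \<open>\<Delta> j\<close> with \<open>i, j < n\<close> matter.
\<close>

definition decoding_order :: "'v \<Rightarrow> 'v set \<Rightarrow> nat \<Rightarrow> (nat \<Rightarrow> 'v) \<Rightarrow> bool" where
  "decoding_order s N n ord \<longleftrightarrow> ord 0 = s \<and> bij_betw ord {1..n} N"

definition lp_feasible ::
  "nat \<Rightarrow> ('v \<Rightarrow> 'v \<Rightarrow> real) \<Rightarrow> real \<Rightarrow> (nat \<Rightarrow> 'v) \<Rightarrow> (nat \<Rightarrow> nat \<Rightarrow> real) \<Rightarrow> (nat \<Rightarrow> real) \<Rightarrow> bool"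
where
  "lp_feasible n C Imax ord A \<Delta> \<longleftrightarrow>
     (\<forall>m\<in>{1..n}. (\<Sum>i<m. \<Sum>j<m. A i j * C (ord i) (ord m)) \<ge> Imax) \<and>
     (\<forall>j<n. (\<Sum>i\<le>j. A i j) \<le> \<Delta> j) \<and>
     (\<forall>i<n. \<forall>j<n. A i j \<ge> 0) \<and>
     (\<forall>i<n. \<forall>j<n. i > j \<longrightarrow> A i j = 0) \<and>
     (\<forall>j<n. \<Delta> j \<ge> 0)"

definition total_delay :: "nat \<Rightarrow> (nat \<Rightarrow> real) \<Rightarrow> real" where
  "total_delay n \<Delta> = (\<Sum>j<n. \<Delta> j)"

definition broadcast_feasible ::
  "'v \<Rightarrow> 'v set \<Rightarrow> nat \<Rightarrow> ('v \<Rightarrow> 'v \<Rightarrow> real) \<Rightarrow> real \<Rightarrow>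
   (nat \<Rightarrow> 'v) \<Rightarrow> (nat \<Rightarrow> nat \<Rightarrow> real) \<Rightarrow> (nat \<Rightarrow> real) \<Rightarrow> bool"
where
  "broadcast_feasible s N n C Imax ord A \<Delta> \<longleftrightarrow>
     decoding_order s N n ord \<and> lp_feasible n C Imax ord A \<Delta>"

definition broadcast_optimal ::
  "'v \<Rightarrow> 'v set \<Rightarrow> nat \<Rightarrow> ('v \<Rightarrow> 'v \<Rightarrow> real) \<Rightarrow> real \<Rightarrow>
   (nat \<Rightarrow> 'v) \<Rightarrow> (nat \<Rightarrow> nat \<Rightarrow> real) \<Rightarrow> (nat \<Rightarrow> real) \<Rightarrow> bool"
where
  "broadcast_optimal s N n C Imax ord A \<Delta> \<longleftrightarrow>
     broadcast_feasible s N n C Imax ord A \<Delta> \<and>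
     (\<forall>ord' A' \<Delta>'. broadcast_feasible s N n C Imax ord' A' \<Delta>' \<longrightarrow>
        total_delay n \<Delta> \<le> total_delay n \<Delta>')"

end

theory Submission
  imports Defs
begin

text \<open>
  A transmission of node \<open>i\<close> made earlier reaches every node it reached before.  So all
  transmissions of node \<open>i\<close> can be moved to stage \<open>i\<close>, the first one in which \<open>i\<close> holds the
  packet; \<open>lp_feasible\<close> does not force node \<open>i + 1\<close> to decode as soon as it can, so stage \<open>i\<close>
  may be lengthened accordingly.
\<close>

definition airtime :: "nat \<Rightarrow> (nat \<Rightarrow> nat \<Rightarrow> real) \<Rightarrow> nat \<Rightarrow> real" where
  "airtime n A i = (\<Sum>j<n. A i j)"

definition advanced :: "nat \<Rightarrow> (nat \<Rightarrow> nat \<Rightarrow> real) \<Rightarrow> nat \<Rightarrow> nat \<Rightarrow> real" where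
  "advanced n A i j = (if j = i then airtime n A i else 0)"

lemma lp_feasible_advanced:
  assumes feas: "lp_feasible n C Imax ord A \<Delta>"
    and C: "\<And>i m. i < m \<Longrightarrow> m \<le> n \<Longrightarrow> C (ord i) (ord m) \<ge> 0"
  shows "lp_feasible n C Imax ord (advanced n A) (airtime n A)"
proof -
  have A: "A i j \<ge> 0" if "i < n" "j < n" for i j
    using feas that by (auto simp: lp_feasible_def)
  have B: "airtime n A i \<ge> 0" if "i < n" for i
    using A that by (auto simp: airtime_def intro: sum_nonneg)
  have "Imax \<le> (\<Sum>i<m. \<Sum>j<m. advanced n A i j * C (ord i) (ord m))" if m: "m \<in> {1..n}" for m
  proof -
    have "Imax \<le> (\<Sum>i<m. \<Sum>j<m. A i j * C (ord i) (ord m))"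
      using feas m by (auto simp: lp_feasible_def)
    also have "\<dots> \<le> (\<Sum>i<m. \<Sum>j<m. advanced n A i j * C (ord i) (ord m))"
    proof (rule sum_mono)
      fix i assume i: "i \<in> {..<m}"
      have "(\<Sum>j<m. A i j) \<le> airtime n A i"
        unfolding airtime_def using i m by (intro sum_mono2) (auto intro: A)
      also have "\<dots> = (\<Sum>j<m. advanced n A i j)"
        using i by (simp add: advanced_def)
      finally show "(\<Sum>j<m. A i j * C (ord i) (ord m)) \<le> (\<Sum>j<m. advanced n A i j * C (ord i) (ord m))"
        using i m C[of i m] by (simp add: sum_distrib_right[symmetric] mult_right_mono)
    qed
    finally show ?thesis .
  qed
  moreover have "(\<Sum>i\<le>j. advanced n A i j) = airtime n A j" for j
    by (simp add: advanced_def)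
  ultimately show ?thesis
    using B by (auto simp: lp_feasible_def advanced_def)
qed

lemma total_delay_airtime_le:
  assumes feas: "lp_feasible n C Imax ord A \<Delta>"
  shows "total_delay n (airtime n A) \<le> total_delay n \<Delta>"
proof -
  have "total_delay n (airtime n A) = (\<Sum>j<n. \<Sum>i<n. A i j)"
    unfolding total_delay_def airtime_def by (rule sum.swap)
  also have "\<dots> \<le> (\<Sum>j<n. \<Delta> j)"
  proof (rule sum_mono)
    fix j assume j: "j \<in> {..<n}"
    have "(\<Sum>i<n. A i j) = (\<Sum>i\<le>j. A i j)"
      using feas j by (intro sum.mono_neutral_right) (auto simp: lp_feasible_def)
    also have "\<dots> \<le> \<Delta> j"
      using feas j by (auto simp: lp_feasible_def)
    finally show "(\<Sum>i<n. A i j) \<le> \<Delta> j" .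
  qed
  finally show ?thesis by (simp add: total_delay_def)
qed

lemma decoding_order_inj_on:
  assumes "decoding_order s N n ord" and "s \<notin> N"
  shows "inj_on ord {..n}"
proof -
  have "{..n} = insert 0 {1..n}" by auto
  then show ?thesis
    using assms by (auto simp: decoding_order_def bij_betw_def)
qed

lemma decoding_order_in:
  assumes "decoding_order s N n ord" and "i \<le> n"
  shows "ord i \<in> insert s N"
  using assms by (cases "i = 0") (auto simp: decoding_order_def bij_betw_def)

theorem theorem4:
  fixes s :: 'v and N :: "'v set" and n :: nat
    and C :: "'v \<Rightarrow> 'v \<Rightarrow> real" and Imax :: real
  assumes "finite N" and "card N = n" and "s \<notin> N"
    and "\<And>u v. u \<in> insert s N \<Longrightarrow> v \<in> insert s N \<Longrightarrow> u \<noteq> v \<Longrightarrow> C u v \<ge> 0"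
    and "Imax > 0"
    and "\<exists>ord A \<Delta>. broadcast_optimal s N n C Imax ord A \<Delta>"
  shows "\<exists>ord A \<Delta>. broadcast_optimal s N n C Imax ord A \<Delta> \<and>
           (\<forall>j<n. \<exists>\<^sub>\<le>\<^sub>1i. i < n \<and> A i j > 0)"
proof -
  obtain ord A \<Delta> where opt: "broadcast_optimal s N n C Imax ord A \<Delta>"
    using assms(6) by blast
  then have ord: "decoding_order s N n ord" and feas: "lp_feasible n C Imax ord A \<Delta>"
    by (auto simp: broadcast_optimal_def broadcast_feasible_def)
  have "C (ord i) (ord m) \<ge> 0" if "i < m" "m \<le> n" for i m
  proof (rule assms(4))
    show "ord i \<in> insert s N" "ord m \<in> insert s N"
      using that by (auto intro!: decoding_order_in[OF ord, simplified])
    show "ord i \<noteq> ord m"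
      using that inj_onD[OF decoding_order_inj_on[OF ord \<open>s \<notin> N\<close>], of i m] by auto
  qed
  then have "lp_feasible n C Imax ord (advanced n A) (airtime n A)"
    by (rule lp_feasible_advanced[OF feas])
  then have "broadcast_optimal s N n C Imax ord (advanced n A) (airtime n A)"
    using opt total_delay_airtime_le[OF feas]
    by (auto simp: broadcast_optimal_def broadcast_feasible_def intro: order_trans)
  moreover have "\<forall>j<n. \<exists>\<^sub>\<le>\<^sub>1i. i < n \<and> advanced n A i j > 0"
    by (auto simp: Uniq_def advanced_def split: if_splits)
  ultimately show ?thesis by blast
qed

end
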